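(* Let $G$ be a constant spinal group with rooted group $R$ acting on $X^\ast$, $X=\underline{R}$. Let $g \in G$ be a finitary automorphism and let $u \in X^\ast \smallsetminus \{\varnothing\}$. Then $g|^u \in R'$, where $R'$ is the commutator subgroup of $R$.
   Context: For a finite non-empty set $X$, $X^\ast$ denotes the rooted tree of finite words over $X$, with root the empty word $\varnothing$. $\mathrm{Aut}(X^\ast)$ acts on the left. For $g\in\mathrm{Aut}(X^\ast)$ and $v\in X^\ast$, the section $g|_v\in \mathrm{Aut}(X^\ast)$ is defined by $g(vu)=g(v)\,g|_v(u)$ for all $u\in X^\ast$, and the label $g|^v\in\mathrm{Sym}(X)$ by $g(vx)=g(v)\,g|^v(x)$ for all $x\in X$. An automorphism $g$ is finitary if $g|^u$ is trivial for all but finitely many vertices $u$. Constant spinal groups: let $R$ be a finite group with identity $e$, let $X=\underline{R}$ be its underlying set, and write $\underline{r}\in X$ for the letter corresponding to $r\in R$. The group $R$ is regarded as a subgroup of $\mathrm{Sym}(X)$ via $r\underline{s}=\underline{rs}$, and $r\in R$ is also identified with the rooted automorphism $\underline{s}w\mapsto \underline{rs}\,w$ of $X^\ast$. An automorphism $d$ is directed if it fixes every word of length $1$, $d|_{\underline{e}}=d$, and $d|_x\in R$ for all $x\in X\smallsetminus\{\underline{e}\}$. Let $D$ be a group of directed automorphisms with $\langle d|_x \mid d\in D,\ x\in X\smallsetminus\{\underline{e}\}\rangle = R$. Then $G=\langle R\cup D\rangle$ is called a constant spinal group with rooted group $R$. All labels of elements of $G$ lie in $R\le \mathrm{Sym}(X)$.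 *)

theory Defs
  imports "HOL-Algebra.Bij" "HOL-Algebra.Generated_Groups"
begin

text \<open>The vertices of the rooted tree over \<open>X\<close> are the words \<open>lists X\<close>, with root \<open>[]\<close>; edges join
  a word to its extensions by one letter.  Automorphisms of the rooted tree are graph automorphisms
  fixing the root.  As in \<open>HOL-Algebra.Bij\<close>, they are extensional functions (\<open>undefined\<close> outside
  \<open>lists X\<close>), so that equality in the group is equality of maps on the tree.\<close>

definition tree_adj :: "'a list \<Rightarrow> 'a list \<Rightarrow> bool" where
  "tree_adj v w \<longleftrightarrow> (\<exists>x. w = v @ [x] \<or> v = w @ [x])"

definition tree_aut :: "'a set \<Rightarrow> ('a list \<Rightarrow> 'a list) set" where
  "tree_aut X = {g \<in> Bij (lists X). g [] = [] \<and>
     (\<forall>v\<in>lists X. \<forall>w\<in>lists X. tree_adj (g v) (g w) \<longleftrightarrow> tree_adj v w)}"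

definition TreeAut :: "'a set \<Rightarrow> ('a list \<Rightarrow> 'a list) monoid" where
  "TreeAut X = BijGroup (lists X) \<lparr>carrier := tree_aut X\<rparr>"

text \<open>The defining equation \<open>g (v @ u) = g v @ tree_section X g v u\<close> is solved for the section by
  deleting the prefix \<open>g v\<close>, and similarly for the label; that the equations do hold is
  \<open>tree_section_append\<close> and \<open>label_append\<close> below.\<close>

definition tree_section :: "'a set \<Rightarrow> ('a list \<Rightarrow> 'a list) \<Rightarrow> 'a list \<Rightarrow> ('a list \<Rightarrow> 'a list)" where
  "tree_section X g v = (\<lambda>u\<in>lists X. drop (length (g v)) (g (v @ u)))"

definition label :: "'a set \<Rightarrow> ('a list \<Rightarrow> 'a list) \<Rightarrow> 'a list \<Rightarrow> ('a \<Rightarrow> 'a)" where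
  "label X g v = (\<lambda>x\<in>X. last (g (v @ [x])))"

definition finitary :: "'a set \<Rightarrow> ('a list \<Rightarrow> 'a list) \<Rightarrow> bool" where
  "finitary X g \<longleftrightarrow> g \<in> tree_aut X \<and> finite {u \<in> lists X. label X g u \<noteq> \<one>\<^bsub>BijGroup X\<^esub>}"

text \<open>The alphabet of a constant spinal group is \<open>X = carrier R\<close>, so that the letter corresponding
  to \<open>r\<close> is \<open>r\<close> itself.  \<open>left_mult R\<close> embeds \<open>R\<close> into the symmetric group of the alphabet,
  \<open>rooted R\<close> embeds it into the automorphism group of the tree.\<close>

definition left_mult :: "('a, 'b) monoid_scheme \<Rightarrow> 'a \<Rightarrow> ('a \<Rightarrow> 'a)" where
  "left_mult R r = (\<lambda>s\<in>carrier R. r \<otimes>\<^bsub>R\<^esub> s)"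

definition rooted :: "('a, 'b) monoid_scheme \<Rightarrow> 'a \<Rightarrow> ('a list \<Rightarrow> 'a list)" where
  "rooted R r = (\<lambda>v\<in>lists (carrier R). case v of [] \<Rightarrow> [] | s # w \<Rightarrow> (r \<otimes>\<^bsub>R\<^esub> s) # w)"

definition directed :: "('a, 'b) monoid_scheme \<Rightarrow> ('a list \<Rightarrow> 'a list) \<Rightarrow> bool" where
  "directed R d \<longleftrightarrow> d \<in> tree_aut (carrier R) \<and>
     (\<forall>x\<in>carrier R. d [x] = [x]) \<and>
     tree_section (carrier R) d [\<one>\<^bsub>R\<^esub>] = d \<and>
     (\<forall>x\<in>carrier R - {\<one>\<^bsub>R\<^esub>}. tree_section (carrier R) d [x] \<in> rooted R ` carrier R)"

definition constant_spinal_group ::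
  "('a, 'b) monoid_scheme \<Rightarrow> ('a list \<Rightarrow> 'a list) set \<Rightarrow> bool" where
  "constant_spinal_group R G \<longleftrightarrow> group R \<and> finite (carrier R) \<and>
     (\<exists>D. subgroup D (TreeAut (carrier R)) \<and> (\<forall>d\<in>D. directed R d) \<and>
        generate (TreeAut (carrier R))
          {tree_section (carrier R) d [x] | d x. d \<in> D \<and> x \<in> carrier R - {\<one>\<^bsub>R\<^esub>}}
          = rooted R ` carrier R \<and>
        G = generate (TreeAut (carrier R)) (rooted R ` carrier R \<union> D))"

lemma tree_aut_closed: "g \<in> tree_aut X \<Longrightarrow> v \<in> lists X \<Longrightarrow> g v \<in> lists X"
  using Bij_imp_funcset unfolding tree_aut_def by blast

lemma tree_aut_snoc:
  assumes g: "g \<in> tree_aut X" and v: "v \<in> lists X" and x: "x \<in> X"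
  shows "\<exists>y\<in>X. g (v @ [x]) = g v @ [y]"
  using v x
proof (induction v arbitrary: x rule: rev_induct)
  have adj: "tree_adj (g v) (g (v @ [x]))" if "v \<in> lists X" "x \<in> X" for v x
    using g that unfolding tree_aut_def by (auto simp: tree_adj_def)
  {
    case Nil
    then show ?case
      using adj[of "[]" x] g tree_aut_closed[OF g, of "[x]"] by (auto simp: tree_adj_def tree_aut_def)
  next
    case (snoc z v)
    let ?w = "v @ [z]"
    have w: "?w \<in> lists X" "v \<in> lists X" "z \<in> X" using snoc.prems by auto
    obtain z' where z': "g ?w = g v @ [z']" using snoc.IH w by blast
    have "inj_on g (lists X)" using g by (auto simp: tree_aut_def Bij_def bij_betw_def)
    moreover have "?w @ [x] \<in> lists X" "?w @ [x] \<noteq> v"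
      using w snoc.prems by auto
    ultimately have ne: "g (?w @ [x]) \<noteq> g v" using w(2) by (metis inj_onD)
    obtain y where "g (?w @ [x]) = g ?w @ [y] \<or> g ?w = g (?w @ [x]) @ [y]"
      using adj[OF w(1) snoc.prems(2)] unfolding tree_adj_def by blast
    with ne z' have y: "g (?w @ [x]) = g ?w @ [y]" by auto
    moreover have "y \<in> X"
      using tree_aut_closed[OF g \<open>?w @ [x] \<in> lists X\<close>] y by auto
    ultimately show ?case by blast
  }
qed

lemma tree_aut_append:
  assumes "g \<in> tree_aut X" "v \<in> lists X" "u \<in> lists X"
  shows "\<exists>w\<in>lists X. length w = length u \<and> g (v @ u) = g v @ w"
  using assms(3)
proof (induction u rule: rev_induct)
  case (snoc x u)
  then obtain w where "w \<in> lists X" "length w = length u" "g (v @ u) = g v @ w" by auto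
  moreover obtain y where "y \<in> X" "g ((v @ u) @ [x]) = g (v @ u) @ [y]"
    using tree_aut_snoc[OF assms(1), of "v @ u" x] assms(2) snoc.prems by auto
  ultimately show ?case by (intro bexI[of _ "w @ [y]"]) auto
qed auto

lemma tree_section_append:
  assumes "g \<in> tree_aut X" "v \<in> lists X" "u \<in> lists X"
  shows "g (v @ u) = g v @ tree_section X g v u"
  using tree_aut_append[OF assms] assms(3) by (auto simp: tree_section_def)

lemma label_append:
  assumes "g \<in> tree_aut X" "v \<in> lists X" "x \<in> X"
  shows "g (v @ [x]) = g v @ [label X g v x]"
  using tree_aut_snoc[OF assms] assms(3) by (auto simp: label_def)

lemma subgroup_tree_aut: "subgroup (tree_aut X) (BijGroup (lists X))"
proof (rule group.subgroupI[OF group_BijGroup])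
  show "tree_aut X \<subseteq> carrier (BijGroup (lists X))"
    by (auto simp: tree_aut_def BijGroup_def)
  have "(\<lambda>x\<in>lists X. x) \<in> tree_aut X"
    using id_Bij[of "lists X"] unfolding tree_aut_def by (simp del: in_lists_conv_set)
  then show "tree_aut X \<noteq> {}" by blast
next
  fix g assume g: "g \<in> tree_aut X"
  let ?h = "restrict (inv_into (lists X) g) (lists X)"
  have B: "g \<in> Bij (lists X)" using g by (simp add: tree_aut_def)
  have gh: "g (?h v) = v" "?h v \<in> lists X" if "v \<in> lists X" for v
    using B that Bij_inv_into_mem[OF B that]
    by (simp_all add: Bij_def bij_betw_def f_inv_into_f del: in_lists_conv_set)
  have "inj_on g (lists X)" using B by (auto simp: Bij_def bij_betw_def)
  moreover have "g (?h []) = g []"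
    using gh(1)[of "[]"] g by (simp add: tree_aut_def)
  ultimately have "?h [] = []"
    by (rule inj_onD) (use gh(2)[of "[]"] in auto)
  moreover have "tree_adj (?h v) (?h w) \<longleftrightarrow> tree_adj v w"
    if "v \<in> lists X" "w \<in> lists X" for v w
  proof -
    have "tree_adj (g (?h v)) (g (?h w)) \<longleftrightarrow> tree_adj (?h v) (?h w)"
      using g gh(2)[OF that(1)] gh(2)[OF that(2)] unfolding tree_aut_def by blast
    then show ?thesis by (simp only: gh(1)[OF that(1)] gh(1)[OF that(2)])
  qed
  ultimately have "?h \<in> tree_aut X"
    using restrict_inv_into_Bij[OF B] unfolding tree_aut_def by blast
  then show "inv\<^bsub>BijGroup (lists X)\<^esub> g \<in> tree_aut X"
    by (simp add: inv_BijGroup[OF B])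
next
  fix g h assume *: "g \<in> tree_aut X" "h \<in> tree_aut X"
  then have B: "g \<in> Bij (lists X)" "h \<in> Bij (lists X)" by (auto simp: tree_aut_def)
  have "compose (lists X) g h \<in> tree_aut X"
    using * compose_Bij[OF B] tree_aut_closed[OF *(2)]
    by (simp add: tree_aut_def compose_eq del: in_lists_conv_set)
  then show "g \<otimes>\<^bsub>BijGroup (lists X)\<^esub> h \<in> tree_aut X"
    using B by (simp add: BijGroup_def)
qed

lemma group_TreeAut: "group (TreeAut X)"
  unfolding TreeAut_def by (rule group.subgroup_imp_group[OF group_BijGroup subgroup_tree_aut])

end

theory Submission
  imports Defs "HOL-Algebra.FiniteProduct"
begin

text \<open>
  Let \<open>\<pi>\<close> be the projection of \<open>R\<close> onto its abelianization \<open>A\<close>, and write an element of the group as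
  the value of a word \<open>w\<close> in rooted and directed automorphisms.  For a letter \<open>z\<close>, let \<open>total w z\<close> be the
  product in \<open>A\<close> of the \<open>\<pi>\<close>-images of the labels at \<open>z\<close> of the factors of \<open>w\<close>; only directed
  factors contribute, because the labels of a rooted automorphism are trivial below the root.

  Passing to the sections at the letters redistributes the directed factors.  A rooted factor becomes
  trivial, while a directed factor \<open>d\<close> occurs again in the section of \<open>w\<close> at exactly one letter \<open>h\<close>, the one which
  the factors to its right carry to \<open>\<one>\<close>; at all other letters \<open>d\<close> turns into a rooted automorphism.
  So \<open>total w z\<close> is the product of the totals of all sections of \<open>w\<close> (\<open>total_eq_prod_sections\<close>).
  Moreover, the label of \<open>w\<close> at \<open>x\<close> is composed of the labels of such factors \<open>d\<close> at
  \<open>inv h \<otimes> x\<close>, so that modulo commutators it is the product over \<open>h\<close> of the totals at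
  \<open>inv h \<otimes> x\<close> of the sections at \<open>h\<close> (\<open>first_label_eq_prod_totals\<close>).

  It remains to see that the totals of a word with finitary value are trivial (\<open>total_finitary\<close>).  This is
  an induction on the number of unrooted factors.  If every section has fewer of them than the word, the
  induction hypothesis applies to the sections, which are finitary too.  Otherwise one
  section has kept all unrooted factors, and then it is a word in directed automorphisms only; its value
  \<open>d\<close> is directed and finitary.  But a directed automorphism repeats its labels at the letters
  along the ray \<open>\<one>\<one>\<one>\<dots>\<close>, so these labels are trivial if it is finitary, and they determine the
  totals.

  Hence the labels on the first level of a finitary element lie in the kernel of \<open>\<pi>\<close>, and the deeper
  levels follow since every section of a finitary element is the finitary value of another such word.
\<close>

section \<open>Sections and labels of tree automorphisms\<close>

lemma tree_aut_bij: "g \<in> tree_aut X \<Longrightarrow> g \<in> Bij (lists X)"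
  by (simp add: tree_aut_def)

lemma tree_aut_mult:
  assumes "g \<in> tree_aut X" "h \<in> tree_aut X"
  shows "g \<otimes>\<^bsub>TreeAut X\<^esub> h = compose (lists X) g h"
  using assms by (simp add: TreeAut_def BijGroup_def tree_aut_bij)

lemma carrier_TreeAut: "carrier (TreeAut X) = tree_aut X"
  by (simp add: TreeAut_def)

lemma one_TreeAut: "\<one>\<^bsub>TreeAut X\<^esub> = (\<lambda>v\<in>lists X. v)"
  by (simp add: TreeAut_def BijGroup_def)

lemma compose_tree_aut:
  assumes "g \<in> tree_aut X" "h \<in> tree_aut X"
  shows "compose (lists X) g h \<in> tree_aut X"
  using group.is_monoid[OF group_TreeAut, of X] monoid.m_closed[of "TreeAut X" g h] assms
  by (simp add: carrier_TreeAut tree_aut_mult)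

lemma id_tree_aut: "(\<lambda>v\<in>lists X. v) \<in> tree_aut X"
  using group.is_monoid[OF group_TreeAut, of X] monoid.one_closed[of "TreeAut X"]
  by (simp add: carrier_TreeAut one_TreeAut)

lemma tree_section_closed:
  assumes "g \<in> tree_aut X" "v \<in> lists X" "u \<in> lists X"
  shows "tree_section X g v u \<in> lists X"
  using tree_aut_append[OF assms] tree_section_append[OF assms] by auto

text \<open>The chain rule for sections, and below its analogue for labels: the right factor acts first and
  moves the vertex at which the left factor is looked at.\<close>

lemma tree_section_compose:
  assumes g: "g \<in> tree_aut X" and h: "h \<in> tree_aut X" and v: "v \<in> lists X"
  shows "tree_section X (compose (lists X) g h) v
    = compose (lists X) (tree_section X g (h v)) (tree_section X h v)"
proof
  fix u
  show "tree_section X (compose (lists X) g h) v u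
    = compose (lists X) (tree_section X g (h v)) (tree_section X h v) u"
  proof (cases "u \<in> lists X")
    case True
    have hv: "h v \<in> lists X" using tree_aut_closed[OF h v] .
    have "g (h (v @ u)) = g (h v) @ tree_section X g (h v) (tree_section X h v u)"
      using tree_section_append[OF h v True]
        tree_section_append[OF g hv tree_section_closed[OF h v True]] by simp
    moreover have "v @ u \<in> lists X" using v True by auto
    ultimately show ?thesis
      using True v by (simp add: tree_section_def[of X "compose _ _ _"] compose_eq del: in_lists_conv_set)
  next
    case False
    then show ?thesis by (simp add: tree_section_def compose_def)
  qed
qed

lemma label_tree_section:
  assumes g: "g \<in> tree_aut X" and v: "v \<in> lists X" and u: "u \<in> lists X"
  shows "label X (tree_section X g v) u = label X g (v @ u)"
proof -
  have "last (tree_section X g v (u @ [x])) = last (g (v @ u @ [x]))" if "x \<in> X" for x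
  proof -
    have ux: "u @ [x] \<in> lists X" using u that by auto
    obtain w where "length w = length (u @ [x])" "g (v @ u @ [x]) = g v @ w"
      using tree_aut_append[OF g v ux] by blast
    then have "w = tree_section X g v (u @ [x])" "w \<noteq> []" "g (v @ u @ [x]) = g v @ w"
      using tree_section_append[OF g v ux] by auto
    then show ?thesis by simp
  qed
  then show ?thesis by (simp add: label_def fun_eq_iff)
qed

lemma label_compose:
  assumes g: "g \<in> tree_aut X" and h: "h \<in> tree_aut X" and v: "v \<in> lists X"
  shows "label X (compose (lists X) g h) v = compose X (label X g (h v)) (label X h v)"
proof
  fix x
  show "label X (compose (lists X) g h) v x = compose X (label X g (h v)) (label X h v) x"
  proof (cases "x \<in> X")
    case True
    have hv: "h v \<in> lists X" using tree_aut_closed[OF h v] .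
    obtain y where y: "y \<in> X" "h (v @ [x]) = h v @ [y]"
      using tree_aut_snoc[OF h v True] by blast
    moreover have "v @ [x] \<in> lists X" using v True by auto
    ultimately show ?thesis
      using True by (simp add: label_def compose_eq del: in_lists_conv_set)
  next
    case False
    then show ?thesis by (simp add: label_def compose_def)
  qed
qed

lemma finitary_tree_section:
  assumes fin: "finitary X g" and sec: "tree_section X g v \<in> tree_aut X" and v: "v \<in> lists X"
  shows "finitary X (tree_section X g v)"
proof -
  have g: "g \<in> tree_aut X" using fin by (simp add: finitary_def)
  let ?B = "\<lambda>g. {u \<in> lists X. label X g u \<noteq> \<one>\<^bsub>BijGroup X\<^esub>}"
  have "(\<lambda>u. v @ u) ` ?B (tree_section X g v) \<subseteq> ?B g"
  proof (rule image_subsetI)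
    fix u assume u: "u \<in> ?B (tree_section X g v)"
    then have "u \<in> lists X" by blast
    from label_tree_section[OF g v this] u this v show "v @ u \<in> ?B g" by auto
  qed
  moreover have "inj_on (\<lambda>u. v @ u) (?B (tree_section X g v))" by (simp add: inj_on_def)
  ultimately have "finite (?B (tree_section X g v))"
    using fin unfolding finitary_def by (metis (no_types, lifting) finite_subset finite_imageD)
  then show ?thesis using sec by (simp add: finitary_def)
qed

section \<open>Rooted and directed automorphisms\<close>

text \<open>On the first level, all labels in a spinal group are left multiplications; evaluating such a label
  at \<open>\<one>\<close> recovers the element of \<open>R\<close> by which it multiplies (see \<open>first_label_eqI\<close>).\<close>

definition first_label :: "('a, 'b) monoid_scheme \<Rightarrow> ('a list \<Rightarrow> 'a list) \<Rightarrow> 'a \<Rightarrow> 'a" where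
  "first_label R g x = label (carrier R) g [x] \<one>\<^bsub>R\<^esub>"

context group
begin

lemma rooted_closed: "r \<in> carrier G \<Longrightarrow> v \<in> lists (carrier G) \<Longrightarrow> rooted G r v \<in> lists (carrier G)"
  by (cases v) (auto simp: rooted_def)

lemma rooted_rooted:
  assumes "r \<in> carrier G" "s \<in> carrier G" "v \<in> lists (carrier G)"
  shows "rooted G r (rooted G s v) = rooted G (r \<otimes> s) v"
  using assms by (cases v) (auto simp: rooted_def m_assoc)

lemma rooted_one: "rooted G \<one> = (\<lambda>v\<in>lists (carrier G). v)"
proof
  fix v show "rooted G \<one> v = (\<lambda>v\<in>lists (carrier G). v) v"
    by (cases v) (auto simp: rooted_def)
qed

text \<open>One implication is enough, because the converse follows by applying it to the inverse
  rooted automorphism.\<close>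

lemma rooted_tree_adj:
  assumes "tree_adj v w" "v \<in> lists (carrier G)" "w \<in> lists (carrier G)"
  shows "tree_adj (rooted G r v) (rooted G r w)"
  using assms by (cases v; cases w) (auto simp: rooted_def tree_adj_def append_eq_Cons_conv Cons_eq_append_conv)

lemma rooted_tree_aut:
  assumes r: "r \<in> carrier G"
  shows "rooted G r \<in> tree_aut (carrier G)"
proof -
  let ?L = "lists (carrier G)"
  have inv: "rooted G (inv r) (rooted G r v) = v" "rooted G r (rooted G (inv r) v) = v"
    if "v \<in> ?L" for v
    using that r by (simp_all add: rooted_rooted rooted_one del: in_lists_conv_set)
  have "bij_betw (rooted G r) ?L ?L"
    by (rule bij_betw_byWitness[where f' = "rooted G (inv r)"])
      (simp_all add: inv r rooted_closed image_subset_iff del: in_lists_conv_set)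
  moreover have "rooted G r \<in> extensional ?L" by (simp add: rooted_def)
  moreover have "rooted G r [] = []" by (simp add: rooted_def)
  moreover have "tree_adj (rooted G r v) (rooted G r w) \<longleftrightarrow> tree_adj v w"
    if vw: "v \<in> ?L" "w \<in> ?L" for v w
  proof
    assume "tree_adj (rooted G r v) (rooted G r w)"
    from rooted_tree_adj[OF this rooted_closed[OF r vw(1)] rooted_closed[OF r vw(2)], of "inv r"]
    show "tree_adj v w" using vw inv by simp
  qed (use rooted_tree_adj vw in blast)
  ultimately show ?thesis by (simp add: tree_aut_def Bij_def)
qed

lemma rooted_letter: "x \<in> carrier G \<Longrightarrow> rooted G r [x] = [r \<otimes> x]"
  by (simp add: rooted_def)

lemma tree_section_rooted:
  assumes "r \<in> carrier G" "x \<in> carrier G"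
  shows "tree_section (carrier G) (rooted G r) [x] = rooted G \<one>"
proof
  fix v
  show "tree_section (carrier G) (rooted G r) [x] v = rooted G \<one> v"
    using assms by (cases v) (auto simp: tree_section_def rooted_def)
qed

lemma label_rooted:
  assumes "r \<in> carrier G" "x \<in> carrier G"
  shows "label (carrier G) (rooted G r) [x] = left_mult G \<one>"
  using assms by (auto simp: label_def rooted_def left_mult_def fun_eq_iff)

lemma label_root_rooted:
  assumes "r \<in> carrier G"
  shows "label (carrier G) (rooted G r) [] = left_mult G r"
  using assms by (auto simp: label_def rooted_def left_mult_def fun_eq_iff)

lemma left_mult_one: "left_mult G \<one> = \<one>\<^bsub>BijGroup (carrier G)\<^esub>"
  by (auto simp: left_mult_def BijGroup_def fun_eq_iff)

lemma first_label_eqI: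
  assumes "label (carrier G) g [x] = left_mult G r" "r \<in> carrier G"
  shows "first_label G g x = r"
  using assms by (simp add: first_label_def left_mult_def)

lemma compose_left_mult:
  assumes "r \<in> carrier G" "s \<in> carrier G"
  shows "compose (carrier G) (left_mult G r) (left_mult G s) = left_mult G (r \<otimes> s)"
  using assms by (auto simp: compose_def left_mult_def fun_eq_iff m_assoc)

lemma inv_rooted:
  assumes "r \<in> carrier G"
  shows "inv\<^bsub>TreeAut (carrier G)\<^esub> (rooted G r) = rooted G (inv r)"
proof (rule group.inv_equality[OF group_TreeAut])
  show "rooted G (inv r) \<otimes>\<^bsub>TreeAut (carrier G)\<^esub> rooted G r = \<one>\<^bsub>TreeAut (carrier G)\<^esub>"
    using assms
    by (auto simp: tree_aut_mult rooted_tree_aut one_TreeAut compose_def rooted_rooted rooted_one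
        fun_eq_iff simp del: in_lists_conv_set)
qed (use assms in \<open>auto simp: carrier_TreeAut rooted_tree_aut\<close>)

text \<open>Since a directed \<open>d\<close> is its own section at \<open>\<one>\<close>, its label at \<open>[x]\<close> reappears at the infinitely many
  vertices \<open>\<one>\<dots>\<one>x\<close>.\<close>

lemma first_label_directed_finitary:
  assumes d: "directed G d" and fin: "finitary (carrier G) d" and x: "x \<in> carrier G"
  shows "first_label G d x = \<one>"
proof -
  let ?X = "carrier G"
  have aut: "d \<in> tree_aut ?X" and sec: "tree_section ?X d [\<one>] = d"
    using d by (auto simp: directed_def)
  let ?w = "\<lambda>n. replicate n \<one> @ [x]"
  have lab: "label ?X d (?w n) = label ?X d [x]" for n
  proof (induction n)
    case (Suc n)
    have "?w n \<in> lists ?X" using x by auto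
    then have "label ?X d ([\<one>] @ ?w n) = label ?X d (?w n)"
      using label_tree_section[OF aut, of "[\<one>]" "?w n"] sec by simp
    then show ?case using Suc by simp
  qed simp
  have "inj ?w" by (auto intro!: injI simp: dest: arg_cong[where f = length])
  then have "infinite (range ?w)" using finite_imageD by blast
  moreover have "finite {u \<in> lists ?X. label ?X d u \<noteq> \<one>\<^bsub>BijGroup ?X\<^esub>}"
    using fin by (simp add: finitary_def)
  ultimately obtain n where "?w n \<notin> {u \<in> lists ?X. label ?X d u \<noteq> \<one>\<^bsub>BijGroup ?X\<^esub>}"
    by (meson finite_subset image_subsetI)
  then have "label ?X d [x] = left_mult G \<one>"
    using lab[of n] x by (auto simp: left_mult_one)
  then show ?thesis by (rule first_label_eqI) simp
qed

end

section \<open>Words in rooted and directed automorphisms\<close>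

primrec word_aut :: "'a set \<Rightarrow> ('a list \<Rightarrow> 'a list) list \<Rightarrow> ('a list \<Rightarrow> 'a list)" where
  "word_aut X [] = (\<lambda>v\<in>lists X. v)"
| "word_aut X (a # w) = compose (lists X) a (word_aut X w)"

text \<open>The factors of the product given by the chain rule for sections.  Nothing is cancelled, so that a
  factor which became trivial still has its place in the word.\<close>

primrec word_section ::
  "'a set \<Rightarrow> ('a list \<Rightarrow> 'a list) list \<Rightarrow> 'a \<Rightarrow> ('a list \<Rightarrow> 'a list) list" where
  "word_section X [] x = []"
| "word_section X (a # w) x = tree_section X a (word_aut X w [x]) # word_section X w x"

text \<open>The homomorphism \<open>\<pi>\<close> stands for the projection of \<open>R\<close> onto its abelianization, whose kernel is the
  commutator subgroup.\<close>

locale spinal_words = group R + A: comm_group A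
  for R :: "('a, 'b) monoid_scheme" (structure) and A :: "('c, 'd) monoid_scheme" +
  fixes D :: "('a list \<Rightarrow> 'a list) set" and \<pi> :: "'a \<Rightarrow> 'c"
  assumes fin: "finite (carrier R)"
    and D_subgroup: "subgroup D (TreeAut (carrier R))"
    and D_directed: "\<And>d. d \<in> D \<Longrightarrow> directed R d"
    and \<pi>_hom: "\<pi> \<in> hom R A"
begin

abbreviation "X \<equiv> carrier R"
abbreviation "rooteds \<equiv> rooted R ` X"
abbreviation "gens \<equiv> rooteds \<union> D"

sublocale pi: group_hom R A \<pi>
  by unfold_locales (rule \<pi>_hom)

lemma gen_tree_aut: "a \<in> gens \<Longrightarrow> a \<in> tree_aut X"
  using D_directed rooted_tree_aut by (auto simp: directed_def)

lemma id_in_D: "rooted R \<one> \<in> D"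
  using subgroup.one_closed[OF D_subgroup] by (simp add: one_TreeAut rooted_one)

lemma gen_first_level:
  assumes "a \<in> gens"
  obtains t where "t \<in> X" "\<And>x. x \<in> X \<Longrightarrow> a [x] = [t \<otimes> x]"
  using assms
proof
  assume "a \<in> D"
  then show thesis using that[of \<one>] D_directed by (auto simp: directed_def)
next
  assume "a \<in> rooteds"
  then show thesis using that rooted_letter by auto
qed

lemma gen_section:
  assumes "a \<in> gens" "x \<in> X"
  shows "tree_section X a [x] \<in> gens"
  using assms(1)
proof
  assume a: "a \<in> D"
  show ?thesis
    using D_directed[OF a] a assms(2) by (cases "x = \<one>") (auto simp: directed_def)
next
  assume "a \<in> rooteds"
  then show ?thesis using tree_section_rooted assms(2) by auto
qed

lemma gen_label:
  assumes "a \<in> gens" "x \<in> X"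
  shows "first_label R a x \<in> X" "label X a [x] = left_mult R (first_label R a x)"
proof -
  have "\<exists>r\<in>X. label X a [x] = left_mult R r"
    using assms(1)
  proof
    assume a: "a \<in> D"
    then have aut: "a \<in> tree_aut X" using gen_tree_aut by blast
    have *: "label X a [x] = label X (tree_section X a [x]) []"
      using label_tree_section[OF aut, of "[x]" "[]"] assms(2) by simp
    show ?thesis
    proof (cases "x = \<one>")
      case True
      \<comment> \<open>At the distinguished letter the section of \<open>a\<close> is \<open>a\<close> itself, which fixes the first level.\<close>
      then have "label X a [x] = label X a []"
        using * D_directed[OF a] by (simp add: directed_def)
      also have "\<dots> = left_mult R \<one>"
        using D_directed[OF a] by (auto simp: directed_def label_def left_mult_def fun_eq_iff)
      finally show ?thesis by blast
    next
      case False
      then obtain r where "r \<in> X" "tree_section X a [x] = rooted R r"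
        using D_directed[OF a] assms(2) by (auto simp: directed_def)
      then show ?thesis using * label_root_rooted by auto
    qed
  next
    assume "a \<in> rooteds"
    then show ?thesis using label_rooted assms(2) by auto
  qed
  then obtain r where "r \<in> X" "label X a [x] = left_mult R r" by blast
  with first_label_eqI[OF this(2,1)]
  show "first_label R a x \<in> X" "label X a [x] = left_mult R (first_label R a x)" by auto
qed

lemma first_label_rooted: "a \<in> rooteds \<Longrightarrow> x \<in> X \<Longrightarrow> first_label R a x = \<one>"
  using first_label_eqI[OF label_rooted] by auto

text \<open>The reason why sections only redistribute labels: the label at \<open>x\<close> of a generator survives in
  its section at \<open>\<one>\<close>, and all its other sections are rooted.\<close>

lemma first_label_gen_section:
  assumes "a \<in> gens" "x \<in> X" "y \<in> X"
  shows "first_label R (tree_section X a [y]) x = (if y = \<one> then first_label R a x else \<one>)"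
  using assms(1)
proof
  assume a: "a \<in> D"
  show ?thesis
    using D_directed[OF a] assms first_label_rooted by (auto simp: directed_def)
next
  assume a: "a \<in> rooteds"
  then show ?thesis
    using first_label_rooted[OF _ assms(2)] tree_section_rooted assms(3) by auto
qed

lemma word_tree_aut: "set w \<subseteq> gens \<Longrightarrow> word_aut X w \<in> tree_aut X"
  by (induction w) (auto simp: id_tree_aut compose_tree_aut gen_tree_aut)

lemma word_first_level:
  assumes "set w \<subseteq> gens"
  obtains t where "t \<in> X" "\<And>x. x \<in> X \<Longrightarrow> word_aut X w [x] = [t \<otimes> x]"
  using assms
proof (induction w arbitrary: thesis)
  case Nil
  show ?case by (rule Nil(1)[of \<one>]) auto
next
  case (Cons a w)
  obtain t where t: "t \<in> X" "\<And>x. x \<in> X \<Longrightarrow> word_aut X w [x] = [t \<otimes> x]"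
    using Cons.IH Cons.prems(2) by auto
  obtain s where s: "s \<in> X" "\<And>x. x \<in> X \<Longrightarrow> a [x] = [s \<otimes> x]"
    using gen_first_level Cons.prems(2) by auto
  show ?case
    by (rule Cons.prems(1)[of "s \<otimes> t"]) (use s t in \<open>auto simp: compose_def m_assoc\<close>)
qed

lemma word_first_level_at:
  assumes "set w \<subseteq> gens" "x \<in> X"
  obtains t where "t \<in> X" "word_aut X w [x] = [t \<otimes> x]"
  using word_first_level[OF assms(1)] assms(2) by blast

lemma word_section_gens:
  assumes "set w \<subseteq> gens" "x \<in> X"
  shows "set (word_section X w x) \<subseteq> gens"
  using assms(1)
proof (induction w)
  case (Cons a w)
  then have "set w \<subseteq> gens" by simp
  then obtain t where "t \<in> X" "word_aut X w [x] = [t \<otimes> x]"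
    using word_first_level_at[OF _ assms(2)] by blast
  then have "tree_section X a (word_aut X w [x]) \<in> gens"
    using gen_section[of a "t \<otimes> x"] Cons.prems assms(2) by auto
  then show ?case using Cons by simp
qed simp

lemma word_section_aut:
  assumes "set w \<subseteq> gens" "x \<in> X"
  shows "tree_section X (word_aut X w) [x] = word_aut X (word_section X w x)"
  using assms(1)
proof (induction w)
  case Nil
  then show ?case using assms(2) by (auto simp: tree_section_def fun_eq_iff)
next
  case (Cons a w)
  then show ?case
    using tree_section_compose[of a X "word_aut X w" "[x]"] gen_tree_aut[of a]
      word_tree_aut[of w] assms(2) by simp
qed

lemma finitary_word_section:
  assumes "set w \<subseteq> gens" "x \<in> X" "finitary X (word_aut X w)"
  shows "finitary X (word_aut X (word_section X w x))"
  using finitary_tree_section[OF assms(3), of "[x]"] word_section_aut[OF assms(1,2)]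
    word_tree_aut[OF word_section_gens[OF assms(1,2)]] assms(2) by simp

lemma word_label_Cons:
  assumes "set (a # w) \<subseteq> gens" "x \<in> X" "t \<in> X" "word_aut X w [x] = [t \<otimes> x]"
    and "r \<in> X" "label X (word_aut X w) [x] = left_mult R r"
  shows "label X (word_aut X (a # w)) [x] = left_mult R (first_label R a (t \<otimes> x) \<otimes> r)"
  using assms label_compose[of a X "word_aut X w" "[x]"] gen_tree_aut[of a] word_tree_aut[of w]
    gen_label[of a "t \<otimes> x"] by (simp add: compose_left_mult)

lemma word_label:
  assumes "set w \<subseteq> gens" "x \<in> X"
  shows "first_label R (word_aut X w) x \<in> X"
    and "label X (word_aut X w) [x] = left_mult R (first_label R (word_aut X w) x)"
proof -
  have "\<exists>r\<in>X. label X (word_aut X w) [x] = left_mult R r"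
    using assms(1)
  proof (induction w)
    case Nil
    have "label X (word_aut X []) [x] = left_mult R \<one>"
      using assms(2) by (auto simp: label_def left_mult_def fun_eq_iff)
    then show ?case by blast
  next
    case (Cons a w)
    have w: "set w \<subseteq> gens" using Cons.prems by simp
    obtain t where t: "t \<in> X" "word_aut X w [x] = [t \<otimes> x]"
      using word_first_level_at[OF w assms(2)] by blast
    obtain r where "r \<in> X" "label X (word_aut X w) [x] = left_mult R r" using Cons by auto
    from word_label_Cons[OF Cons.prems assms(2) t this] this(1) t(1)
    show ?case
      using gen_label(1)[of a "t \<otimes> x"] Cons.prems assms(2) by auto
  qed
  then obtain r where "r \<in> X" "label X (word_aut X w) [x] = left_mult R r" by blast
  with first_label_eqI[OF this(2,1)]
  show "first_label R (word_aut X w) x \<in> X"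
    "label X (word_aut X w) [x] = left_mult R (first_label R (word_aut X w) x)" by auto
qed

lemma first_label_Cons:
  assumes "set (a # w) \<subseteq> gens" "x \<in> X" "t \<in> X" "word_aut X w [x] = [t \<otimes> x]"
  shows "first_label R (word_aut X (a # w)) x
    = first_label R a (t \<otimes> x) \<otimes> first_label R (word_aut X w) x"
proof (rule first_label_eqI)
  have w: "set w \<subseteq> gens" using assms(1) by simp
  note r = word_label[OF w assms(2)]
  show "label X (word_aut X (a # w)) [x]
    = left_mult R (first_label R a (t \<otimes> x) \<otimes> first_label R (word_aut X w) x)"
    by (rule word_label_Cons[OF assms r])
  show "first_label R a (t \<otimes> x) \<otimes> first_label R (word_aut X w) x \<in> X"
    using gen_label(1)[of a "t \<otimes> x"] r(1) assms by simp
qed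

section \<open>Totals of words in the abelian quotient\<close>

primrec total :: "('a list \<Rightarrow> 'a list) list \<Rightarrow> 'a \<Rightarrow> 'c" where
  "total [] z = \<one>\<^bsub>A\<^esub>"
| "total (a # w) z = \<pi> (first_label R a z) \<otimes>\<^bsub>A\<^esub> total w z"

lemma total_closed: "set w \<subseteq> gens \<Longrightarrow> z \<in> X \<Longrightarrow> total w z \<in> carrier A"
  by (induction w) (auto simp: gen_label)

text \<open>A new factor \<open>a\<close> changes only one of the totals of the sections, namely at the letter that \<open>w\<close>
  moves to \<open>\<one>\<close>, which is \<open>inv t\<close>.  The function \<open>z\<close> serves both product formulas below: it is constant
  for the total of the word, and \<open>h \<mapsto> inv h \<otimes> x\<close> for its label at \<open>x\<close>.\<close>

lemma total_sections_Cons: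
  assumes w: "set (a # w) \<subseteq> gens" and t: "t \<in> X" "\<And>x. x \<in> X \<Longrightarrow> word_aut X w [x] = [t \<otimes> x]"
    and z: "z \<in> X \<rightarrow> X"
  shows "(\<Otimes>\<^bsub>A\<^esub>h\<in>X. total (word_section X (a # w) h) (z h))
    = \<pi> (first_label R a (z (inv t))) \<otimes>\<^bsub>A\<^esub> (\<Otimes>\<^bsub>A\<^esub>h\<in>X. total (word_section X w h) (z h))"
proof -
  let ?F = "\<lambda>h. \<pi> (first_label R a (z h))"
  have a: "a \<in> gens" using w by simp
  have F: "?F \<in> X \<rightarrow> carrier A" using gen_label(1)[OF a] z by (auto simp: Pi_iff)
  have T: "(\<lambda>h. total (word_section X w h) (z h)) \<in> X \<rightarrow> carrier A"
    using total_closed word_section_gens w z by (auto simp: Pi_iff)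
  have step: "total (word_section X (a # w) h) (z h)
      = (if h = inv t then ?F h else \<one>\<^bsub>A\<^esub>) \<otimes>\<^bsub>A\<^esub> total (word_section X w h) (z h)" if h: "h \<in> X" for h
  proof -
    have "t \<otimes> h = \<one> \<longleftrightarrow> h = inv t" using h t(1) by (metis inv_equality inv_inv r_inv inv_closed)
    moreover have "z h \<in> X" using z h by auto
    ultimately show ?thesis
      using h t first_label_gen_section[OF a, of "z h" "t \<otimes> h"] by simp
  qed
  have "(\<Otimes>\<^bsub>A\<^esub>h\<in>X. total (word_section X (a # w) h) (z h))
    = (\<Otimes>\<^bsub>A\<^esub>h\<in>X. (if h = inv t then ?F h else \<one>\<^bsub>A\<^esub>) \<otimes>\<^bsub>A\<^esub> total (word_section X w h) (z h))"
    by (rule A.finprod_cong') (use step F T in \<open>auto simp: Pi_iff\<close>)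
  also have "\<dots> = (\<Otimes>\<^bsub>A\<^esub>h\<in>X. if h = inv t then ?F h else \<one>\<^bsub>A\<^esub>)
      \<otimes>\<^bsub>A\<^esub> (\<Otimes>\<^bsub>A\<^esub>h\<in>X. total (word_section X w h) (z h))"
    by (rule A.finprod_multf) (use F T in \<open>auto simp: Pi_iff\<close>)
  also have "(\<Otimes>\<^bsub>A\<^esub>h\<in>X. if h = inv t then ?F h else \<one>\<^bsub>A\<^esub>) = ?F (inv t)"
    by (rule A.finprod_singleton_swap) (use F t fin in auto)
  finally show ?thesis .
qed

lemma total_eq_prod_sections:
  assumes "set w \<subseteq> gens" "z \<in> X"
  shows "total w z = (\<Otimes>\<^bsub>A\<^esub>h\<in>X. total (word_section X w h) z)"
  using assms(1)
proof (induction w)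
  case (Cons a w)
  then have "set w \<subseteq> gens" by simp
  then obtain t where "t \<in> X" "\<And>x. x \<in> X \<Longrightarrow> word_aut X w [x] = [t \<otimes> x]"
    using word_first_level by blast
  from total_sections_Cons[OF Cons.prems this, of "\<lambda>_. z"] show ?case
    using Cons assms(2) by simp
qed simp

text \<open>In the induction step the new factor contributes its label at \<open>t \<otimes> x\<close>, the image of \<open>x\<close>
  under the other factors.  With \<open>h = inv t\<close> this is the letter \<open>inv h \<otimes> x\<close>.\<close>

lemma first_label_eq_prod_totals:
  assumes "set w \<subseteq> gens" "x \<in> X"
  shows "\<pi> (first_label R (word_aut X w) x)
    = (\<Otimes>\<^bsub>A\<^esub>h\<in>X. total (word_section X w h) (inv h \<otimes> x))"
  using assms(1)
proof (induction w)
  case Nil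
  have "label X (word_aut X []) [x] = left_mult R \<one>"
    using assms(2) by (auto simp: label_def left_mult_def fun_eq_iff)
  then have "first_label R (word_aut X []) x = \<one>" by (rule first_label_eqI) simp
  then show ?case by (simp del: word_aut.simps)
next
  case (Cons a w)
  have w: "set w \<subseteq> gens" using Cons.prems by simp
  obtain t where t: "t \<in> X" "\<And>x. x \<in> X \<Longrightarrow> word_aut X w [x] = [t \<otimes> x]"
    using word_first_level[OF w] by blast
  have "\<pi> (first_label R (word_aut X (a # w)) x)
      = \<pi> (first_label R a (t \<otimes> x)) \<otimes>\<^bsub>A\<^esub> \<pi> (first_label R (word_aut X w) x)"
    using first_label_Cons[OF Cons.prems assms(2) t(1) t(2)[OF assms(2)]]
      gen_label(1)[of a "t \<otimes> x"] word_label(1)[of w x] Cons.prems assms(2) t(1) by simp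
  also have "\<dots> = (\<Otimes>\<^bsub>A\<^esub>h\<in>X. total (word_section X (a # w) h) (inv h \<otimes> x))"
    using total_sections_Cons[OF Cons.prems t, of "\<lambda>h. inv h \<otimes> x"] Cons assms(2) t(1)
    by simp
  finally show ?case .
qed

section \<open>Finitary words have trivial totals\<close>

abbreviation unrooted_count :: "('a list \<Rightarrow> 'a list) list \<Rightarrow> nat" where
  "unrooted_count w \<equiv> length (filter (\<lambda>a. a \<notin> rooteds) w)"

lemma unrooted_gen_section:
  assumes "a \<in> gens" "x \<in> X" "tree_section X a [x] \<notin> rooteds"
  shows "a \<notin> rooteds" "x = \<one>" "tree_section X a [x] = a" "a \<in> D"
proof -
  show *: "a \<notin> rooteds" using assms tree_section_rooted by auto
  then show "a \<in> D" using assms(1) by blast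
  then show "x = \<one>" "tree_section X a [x] = a"
    using D_directed assms(2,3) by (auto simp: directed_def)
qed

lemma unrooted_count_section_le:
  assumes "set w \<subseteq> gens" "x \<in> X"
  shows "unrooted_count (word_section X w x) \<le> unrooted_count w"
  using assms(1)
proof (induction w)
  case (Cons a w)
  then have w: "set w \<subseteq> gens" by simp
  then obtain t where "t \<in> X" "word_aut X w [x] = [t \<otimes> x]"
    using word_first_level_at[OF _ assms(2)] by blast
  moreover have "a \<in> gens" using Cons.prems by simp
  ultimately have "tree_section X a (word_aut X w [x]) \<notin> rooteds \<Longrightarrow> a \<notin> rooteds"
    using unrooted_gen_section(1)[of a "t \<otimes> x"] assms(2) by simp
  then show ?case using Cons.IH[OF w] by (simp del: image_iff)
qed simp

text \<open>A section that has lost no unrooted factor arises by replacing the rooted factors of \<open>w\<close>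
  by the identity, which is directed as well and has trivial labels.\<close>

lemma section_keeping_unrooted_gens:
  assumes "set w \<subseteq> gens" "x \<in> X" "z \<in> X" "unrooted_count w \<le> unrooted_count (word_section X w x)"
  shows "set (word_section X w x) \<subseteq> D \<and> total (word_section X w x) z = total w z"
  using assms(1,4)
proof (induction w)
  case (Cons a w)
  then have "set w \<subseteq> gens" by simp
  then obtain t where t: "t \<in> X" "word_aut X w [x] = [t \<otimes> x]"
    using word_first_level_at[OF _ assms(2)] by blast
  let ?b = "tree_section X a (word_aut X w [x])"
  have a: "a \<in> gens" and w: "set w \<subseteq> gens" using Cons.prems by auto
  note le = unrooted_count_section_le[OF w assms(2)]
  show ?case
  proof (cases "a \<in> rooteds")
    case True
    then have b: "?b = rooted R \<one>" using tree_section_rooted t assms(2) by auto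
    then have "first_label R ?b z = first_label R a z"
      using True first_label_rooted assms(3) by auto
    moreover have "unrooted_count w \<le> unrooted_count (word_section X w x)" using Cons.prems(2) True b by auto
    ultimately show ?thesis using Cons.IH[OF w] b id_in_D by auto
  next
    case False
    then have nr: "?b \<notin> rooteds" using Cons.prems(2) le by (auto split: if_splits)
    with unrooted_gen_section[OF a, of "t \<otimes> x"] t assms(2)
    have "?b = a" "a \<in> D" by auto
    moreover have "unrooted_count w \<le> unrooted_count (word_section X w x)" using Cons.prems(2) False nr by auto
    ultimately show ?thesis using Cons.IH[OF w] by auto
  qed
qed simp

text \<open>Directed automorphisms fix the first level, so their labels there multiply without any shift
  of the letter.\<close>

lemma total_directed_word:
  assumes "set w \<subseteq> D" "z \<in> X"
  shows "word_aut X w \<in> D \<and> total w z = \<pi> (first_label R (word_aut X w) z)"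
  using assms(1)
proof (induction w)
  case Nil
  have "word_aut X [] = rooted R \<one>" by (simp add: rooted_one)
  then show ?case using id_in_D first_label_rooted assms(2) by auto
next
  case (Cons a w)
  then have D: "a \<in> D" "word_aut X w \<in> D" and aw: "set (a # w) \<subseteq> gens" by auto
  have "word_aut X (a # w) = a \<otimes>\<^bsub>TreeAut X\<^esub> word_aut X w"
    using D gen_tree_aut by (simp add: tree_aut_mult)
  then have "word_aut X (a # w) \<in> D" using subgroup.m_closed[OF D_subgroup D] by simp
  moreover have "word_aut X w [z] = [\<one> \<otimes> z]"
    using D_directed[OF D(2)] assms(2) by (simp add: directed_def)
  from first_label_Cons[OF aw assms(2) _ this]
  have "\<pi> (first_label R (word_aut X (a # w)) z) = total (a # w) z"
    using Cons gen_label(1)[of _ z] D assms(2) by simp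
  ultimately show ?case by simp
qed

lemma total_finitary:
  assumes "set w \<subseteq> gens" "finitary X (word_aut X w)" "z \<in> X"
  shows "total w z = \<one>\<^bsub>A\<^esub>"
  using assms(1,2)
proof (induction "unrooted_count w" arbitrary: w rule: less_induct)
  case less
  show ?case
    \<comment> \<open>If \<open>w\<close> has an unrooted factor, a section with as many of them as \<open>w\<close> took them all, and the
      other sections have none; the case of a word in rooted automorphisms is covered as well.\<close>
  proof (cases "\<exists>x\<in>X. unrooted_count w \<le> unrooted_count (word_section X w x)")
    case True
    then obtain x where x: "x \<in> X" "unrooted_count w \<le> unrooted_count (word_section X w x)" by blast
    note full = section_keeping_unrooted_gens[OF less.prems(1) x(1) assms(3) x(2)]
    have "finitary X (word_aut X (word_section X w x))"
      by (rule finitary_word_section[OF less.prems(1) x(1) less.prems(2)])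
    then have "total (word_section X w x) z = \<one>\<^bsub>A\<^esub>"
      using full total_directed_word[OF _ assms(3), of "word_section X w x"]
        first_label_directed_finitary[OF D_directed _ assms(3)] by simp
    then show ?thesis using full by simp
  next
    case False
    then have "total (word_section X w x) z = \<one>\<^bsub>A\<^esub>" if "x \<in> X" for x
      using less.hyps[of "word_section X w x"] that word_section_gens[OF less.prems(1) that]
        finitary_word_section[OF less.prems(1) that less.prems(2)] by force
    then show ?thesis
      using total_eq_prod_sections[OF less.prems(1) assms(3)] by (simp add: A.finprod_one_eqI)
  qed
qed

lemma first_label_finitary:
  assumes "set w \<subseteq> gens" "finitary X (word_aut X w)" "x \<in> X"
  shows "\<pi> (first_label R (word_aut X w) x) = \<one>\<^bsub>A\<^esub>"
  unfolding first_label_eq_prod_totals[OF assms(1,3)]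
proof (rule A.finprod_one_eqI)
  fix h assume h: "h \<in> X"
  show "total (word_section X w h) (inv h \<otimes> x) = \<one>\<^bsub>A\<^esub>"
    by (rule total_finitary[OF word_section_gens[OF assms(1) h]
          finitary_word_section[OF assms(1) h assms(2)]]) (use h assms(3) in simp)
qed

lemma label_finitary_word:
  assumes "set w \<subseteq> gens" "finitary X (word_aut X w)" "y \<in> X" "u \<in> lists X"
  shows "\<exists>r\<in>X. \<pi> r = \<one>\<^bsub>A\<^esub> \<and> label X (word_aut X w) (y # u) = left_mult R r"
  using assms
proof (induction u arbitrary: w y)
  case Nil
  then show ?case using word_label[of w y] first_label_finitary[of w y] by auto
next
  case (Cons z u)
  have zu: "z # u \<in> lists X" "z \<in> X" "u \<in> lists X" using Cons.prems by auto
  have "label X (word_aut X w) (y # z # u) = label X (word_aut X (word_section X w y)) (z # u)"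
    using label_tree_section[OF word_tree_aut[OF Cons.prems(1)], of "[y]" "z # u"]
      word_section_aut[OF Cons.prems(1,3)] Cons.prems(3) zu by simp
  then show ?case
    using Cons.IH[OF word_section_gens[OF Cons.prems(1,3)]
        finitary_word_section[OF Cons.prems(1,3,2)] zu(2,3)] by simp
qed

lemma word_aut_append:
  assumes "set v \<subseteq> gens" "set w \<subseteq> gens"
  shows "word_aut X (v @ w) = word_aut X v \<otimes>\<^bsub>TreeAut X\<^esub> word_aut X w"
proof -
  interpret T: group "TreeAut X" by (rule group_TreeAut)
  have aut: "u \<in> carrier (TreeAut X)" if "u \<in> gens" for u
    using gen_tree_aut[OF that] by (simp add: carrier_TreeAut)
  have waut: "word_aut X u \<in> carrier (TreeAut X)" if "set u \<subseteq> gens" for u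
    using word_tree_aut[OF that] by (simp add: carrier_TreeAut)
  have word_Cons: "word_aut X (a # u) = a \<otimes>\<^bsub>TreeAut X\<^esub> word_aut X u" if "a \<in> gens" "set u \<subseteq> gens" for a u
    using gen_tree_aut[OF that(1)] word_tree_aut[OF that(2)] by (simp add: tree_aut_mult)
  show ?thesis
    using assms(1)
  proof (induction v)
    case Nil
    show ?case
      by (simp only: append_Nil word_aut.simps one_TreeAut[symmetric] T.l_one[OF waut[OF assms(2)]])
  next
    case (Cons a v)
    then show ?case
      using aut waut assms(2) Cons(2) T.m_assoc word_Cons
      by (simp del: word_aut.simps)
  qed
qed

lemma generate_word:
  assumes "g \<in> generate (TreeAut X) gens"
  obtains w where "set w \<subseteq> gens" "g = word_aut X w"
proof -
  interpret T: group "TreeAut X" by (rule group_TreeAut)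
  have letter: "\<exists>w. set w \<subseteq> gens \<and> a = word_aut X w" if "a \<in> gens" for a
  proof -
    have "a = word_aut X [a]"
      using gen_tree_aut[OF that] T.r_one[of a] id_tree_aut[of X]
      by (simp add: carrier_TreeAut one_TreeAut tree_aut_mult)
    then show ?thesis using that by (intro exI[of _ "[a]"]) simp
  qed
  have "\<exists>w. set w \<subseteq> gens \<and> g = word_aut X w"
    using assms
  proof (induction rule: generate.induct)
    case one
    show ?case by (rule exI[of _ "[]"]) (simp add: one_TreeAut)
  next
    case (incl h)
    then show ?case by (rule letter)
  next
    case (inv h)
    then have "inv\<^bsub>TreeAut X\<^esub> h \<in> gens"
      using inv_rooted subgroup.m_inv_closed[OF D_subgroup] by auto
    then show ?case by (rule letter)
  next
    case (eng h1 h2)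
    then obtain v w where "set v \<subseteq> gens" "h1 = word_aut X v" "set w \<subseteq> gens" "h2 = word_aut X w"
      by blast
    then show ?case using word_aut_append by (intro exI[of _ "v @ w"]) simp
  qed
  then show thesis using that by blast
qed

end

theorem proposition5p1:
  fixes R :: "('a, 'b) monoid_scheme"
    and G :: "('a list \<Rightarrow> 'a list) set"
    and g :: "'a list \<Rightarrow> 'a list"
    and u :: "'a list"
  assumes "constant_spinal_group R G"
    and "g \<in> G"
    and "finitary (carrier R) g"
    and "u \<in> lists (carrier R) - {[]}"
  shows "label (carrier R) g u \<in> left_mult R ` derived R (carrier R)"
proof -
  interpret group R using assms(1) by (simp add: constant_spinal_group_def)
  obtain D where D: "finite (carrier R)" "subgroup D (TreeAut (carrier R))"
      "\<forall>d\<in>D. directed R d" "G = generate (TreeAut (carrier R)) (rooted R ` carrier R \<union> D)"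
    using assms(1) unfolding constant_spinal_group_def by blast
  let ?N = "derived R (carrier R)"
  interpret N: normal ?N R by (rule derived_self_is_normal)
  interpret A: comm_group "R Mod ?N" by (rule derived_quot_is_comm_group)
  interpret spinal_words R "R Mod ?N" D "\<lambda>r. ?N #>\<^bsub>R\<^esub> r"
    by (intro spinal_words.intro spinal_words_axioms.intro group_axioms A.comm_group_axioms
        N.r_coset_hom_Mod) (use D in auto)
  obtain w where w: "set w \<subseteq> gens" "g = word_aut X w"
    using generate_word assms(2) D(4) by blast
  obtain y v where yv: "u = y # v" "y \<in> X" "v \<in> lists X"
    using assms(4) by (cases u) auto
  obtain r where r: "r \<in> X" "?N #>\<^bsub>R\<^esub> r = ?N" "label X g u = left_mult R r"
    using label_finitary_word[OF w(1) _ yv(2,3)] assms(3) w(2) yv(1) by (auto simp: FactGroup_def)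
  have "r \<in> ?N" by (rule coset_join1[OF r(2,1)]) (rule N.is_subgroup)
  then show ?thesis using r(3) by blast
qed

end
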